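(* Let $\alpha,\beta\in\mathbb{C}$ be such that $\mu=\alpha\beta$ is a positive real number. Then for all integers $m,n,m',n'\ge 0$, with $|M|=m+n+m'+n'$, and all $(z,w)\in\mathbb{C}^2$, $$H_{m,n,m',n'}\left(\frac{z}{\sqrt2},\frac{w}{\sqrt2}\right)=\frac{\mu^2(-\alpha)^{m+n'}\beta^{m'+n}}{\pi^2\sqrt{2}^{\,|M|}}\,e^{|z|^2+|w|^2}\int_{\mathbb{C}^2}(u+iv)^m(\overline{u}-i\overline{v})^n(\overline{u}+i\overline{v})^{m'}(u-iv)^{n'}E(u,v|z,w)\,d\lambda(u,v),$$ where $$E(u,v|z,w)=\exp\left(-\mu|u|^2-\mu|v|^2+\alpha\langle u,z\rangle-\beta\overline{\langle u,z\rangle}+\alpha\langle v,w\rangle-\beta\overline{\langle v,w\rangle}\right).$$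
   Context: For integers $m,n\ge 0$ and $\zeta\in\mathbb{C}$, $H_{m,n}(\zeta,\overline{\zeta})=(-1)^{m+n}e^{|\zeta|^2}\frac{\partial^{m+n}}{\partial\overline{\zeta}^{m}\partial\zeta^{n}}\left(e^{-|\zeta|^2}\right)$ (Wirtinger derivatives), and for $(z,w)\in\mathbb{C}^2$, $H_{m,n,m',n'}(z,w)=H_{m,n}(z+iw,\overline{z}-i\overline{w})\,H_{m',n'}(\overline{z}+i\overline{w},z-iw)$. For $a,b\in\mathbb{C}$, $\langle a,b\rangle=a\overline{b}$. $d\lambda$ is Lebesgue measure on $\mathbb{C}^2=\mathbb{R}^4$. *)

theory Defs
  imports "HOL-Analysis.Analysis"
begin

definition partial_Re :: "(complex \<Rightarrow> complex) \<Rightarrow> complex \<Rightarrow> complex" where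
  "partial_Re f \<zeta> = vector_derivative (\<lambda>t::real. f (\<zeta> + of_real t)) (at 0)"

definition partial_Im :: "(complex \<Rightarrow> complex) \<Rightarrow> complex \<Rightarrow> complex" where
  "partial_Im f \<zeta> = vector_derivative (\<lambda>t::real. f (\<zeta> + \<i> * of_real t)) (at 0)"

definition wirtinger :: "(complex \<Rightarrow> complex) \<Rightarrow> complex \<Rightarrow> complex" where
  "wirtinger f \<zeta> = (partial_Re f \<zeta> - \<i> * partial_Im f \<zeta>) / 2"

definition wirtinger_bar :: "(complex \<Rightarrow> complex) \<Rightarrow> complex \<Rightarrow> complex" where
  "wirtinger_bar f \<zeta> = (partial_Re f \<zeta> + \<i> * partial_Im f \<zeta>) / 2"

text \<open>The usual notation $H_{m,n}(\zeta, \overline{\zeta})$ lists the conjugate of the argument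
  as a second argument; here only \<open>\<zeta>\<close> is kept.\<close>

definition hermite2 :: "nat \<Rightarrow> nat \<Rightarrow> complex \<Rightarrow> complex" where
  "hermite2 m n \<zeta> =
     (- 1) ^ (m + n) * exp (of_real ((cmod \<zeta>)\<^sup>2))
       * (wirtinger_bar ^^ m) ((wirtinger ^^ n) (\<lambda>\<xi>. exp (- of_real ((cmod \<xi>)\<^sup>2)))) \<zeta>"

text \<open>The suppressed second arguments are \<open>cnj z - \<i> * cnj w\<close> and \<open>z - \<i> * w\<close>, the conjugates
  of the first ones.\<close>

definition hermite4 :: "nat \<Rightarrow> nat \<Rightarrow> nat \<Rightarrow> nat \<Rightarrow> complex \<Rightarrow> complex \<Rightarrow> complex" where
  "hermite4 m n m' n' z w = hermite2 m n (z + \<i> * w) * hermite2 m' n' (cnj z + \<i> * cnj w)"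

lemma hermite4_second_args:
  "cnj (z + \<i> * w) = cnj z - \<i> * cnj w"
  "cnj (cnj z + \<i> * cnj w) = z - \<i> * w"
  by simp_all

definition herm :: "complex \<Rightarrow> complex \<Rightarrow> complex" where
  "herm a b = a * cnj b"

definition E_kernel ::
  "real \<Rightarrow> complex \<Rightarrow> complex \<Rightarrow> complex \<Rightarrow> complex \<Rightarrow> complex \<Rightarrow> complex \<Rightarrow> complex" where
  "E_kernel \<mu> \<alpha> \<beta> u v z w =
     exp (- of_real (\<mu> * (cmod u)\<^sup>2) - of_real (\<mu> * (cmod v)\<^sup>2)
          + \<alpha> * herm u z - \<beta> * cnj (herm u z)
          + \<alpha> * herm v w - \<beta> * cnj (herm v w))"

definition hermite4_integrand ::
  "real \<Rightarrow> complex \<Rightarrow> complex \<Rightarrow> nat \<Rightarrow> nat \<Rightarrow> nat \<Rightarrow> nat \<Rightarrow> complex \<Rightarrow> complex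
     \<Rightarrow> complex \<times> complex \<Rightarrow> complex" where
  "hermite4_integrand \<mu> \<alpha> \<beta> m n m' n' z w = (\<lambda>(u, v).
     (u + \<i> * v) ^ m * (cnj u - \<i> * cnj v) ^ n * (cnj u + \<i> * cnj v) ^ m' * (u - \<i> * v) ^ n'
       * E_kernel \<mu> \<alpha> \<beta> u v z w)"

end

theory Submission
  imports Defs "HOL-Probability.Characteristic_Functions"
begin

text \<open>
  The Gaussian \<open>exp (-|x|\<^sup>2 - |y|\<^sup>2)\<close> is an integral over \<open>\<complex>\<^sup>2\<close> of exponentials
  \<open>exp (f\<^sub>1 p * cnj x + h\<^sub>1 p * x + f\<^sub>2 p * cnj y + h\<^sub>2 p * y)\<close> against a Gaussian weight, where
  \<open>f\<^sub>1, h\<^sub>1, f\<^sub>2, h\<^sub>2\<close> are real-linear in \<open>p = (u, v)\<close>, namely multiples of \<open>u + iv\<close>, \<open>u - iv\<close>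
  and their conjugates. On such an integral the Wirtinger
  derivatives act by multiplying the integrand with \<open>h\<^sub>1\<close> (for \<open>x\<close>), \<open>f\<^sub>1\<close> (for the conjugate of \<open>x\<close>),
  and likewise in \<open>y\<close>, which produces the monomial weights. Finally one puts \<open>x = (z + iw) / sqrt 2\<close>
  and \<open>y = (cnj z + i cnj w) / sqrt 2\<close>.
\<close>

section \<open>Gaussian integrals with complex linear terms\<close>

text \<open>This is the characteristic function of the standard normal distribution, with the
  normalising factor \<open>sqrt (2 * pi)\<close> of the density moved to the value.\<close>

lemma has_bochner_integral_gaussian_iexp:
  "has_bochner_integral lborel (\<lambda>x. complex_of_real (exp (- x\<^sup>2 / 2)) * iexp (t * x))
     (of_real (sqrt (2 * pi) * exp (- t\<^sup>2 / 2)))"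
proof -
  have fin: "integrable std_normal_distribution (\<lambda>x. iexp (t * x))"
    by (rule finite_measure.integrable_const_bound[where B = 1])
       (auto simp: prob_space_normal_density prob_space.finite_measure)
  have "has_bochner_integral std_normal_distribution (\<lambda>x. iexp (t * x)) (of_real (exp (- t\<^sup>2 / 2)))"
    using fin fun_cong[OF char_std_normal_distribution, of t]
    by (simp add: char_def has_bochner_integral_iff)
  then have "has_bochner_integral lborel (\<lambda>x. std_normal_density x *\<^sub>R iexp (t * x)) (of_real (exp (- t\<^sup>2 / 2)))"
    by (simp add: has_bochner_integral_iff integrable_density integral_density normal_density_nonneg)
  from has_bochner_integral_mult_right[OF this, of "of_real (sqrt (2 * pi))"]
  show ?thesis
    by (simp add: std_normal_density_def scaleR_conv_of_real mult.assoc real_sqrt_mult)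
qed

text \<open>Completing the square with a real substitution \<open>r + s * x\<close>: the real part
  of \<open>c\<close> is absorbed by the shift, and its imaginary part becomes the frequency of a
  Fourier integral.\<close>

lemma has_bochner_integral_gaussian_complex:
  fixes c :: complex and \<mu> :: real
  assumes "\<mu> > 0"
  shows "has_bochner_integral lborel (\<lambda>x. exp (- of_real (\<mu> * x\<^sup>2) + c * of_real x))
           (of_real (sqrt (pi / \<mu>)) * exp (c\<^sup>2 / of_real (4 * \<mu>)))"
proof -
  \<comment> \<open>\<open>s\<close> is chosen so that \<open>\<mu> * s\<^sup>2 = 1/2\<close>, and
    \<open>r\<close> is the maximum point of \<open>- \<mu> * x\<^sup>2 + Re c * x\<close>.\<close>
  define s r where "s = 1 / sqrt (2 * \<mu>)" and "r = Re c / (2 * \<mu>)"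
  have s: "s > 0" "s\<^sup>2 = 1 / (2 * \<mu>)" and r: "Re c = 2 * \<mu> * r"
    using assms by (auto simp: s_def r_def power_divide)
  \<comment> \<open>Shifting by \<open>r\<close> removes the real part of the linear coefficient.\<close>
  have c: "c = of_real (2 * \<mu> * r) + \<i> * of_real (Im c)"
    using complex_eq[of c] r by simp
  have eq: "exp (- of_real (\<mu> * (r + s * x)\<^sup>2) + c * of_real (r + s * x)) =
      exp (c * of_real r - of_real (\<mu> * r\<^sup>2)) * (complex_of_real (exp (- x\<^sup>2 / 2)) * iexp (Im c * s * x))" for x
  proof -
    have "\<mu> * (r + s * x)\<^sup>2 = \<mu> * r\<^sup>2 + 2 * \<mu> * r * s * x + (\<mu> * s\<^sup>2) * x\<^sup>2"
      by (simp add: power2_eq_square algebra_simps)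
    also have "\<mu> * s\<^sup>2 = 1 / 2" using assms by (simp add: s)
    finally have 1: "\<mu> * (r + s * x)\<^sup>2 = \<mu> * r\<^sup>2 + 2 * \<mu> * r * s * x + x\<^sup>2 / 2" by simp
    have 2: "c * of_real (r + s * x) = c * of_real r + of_real (2 * \<mu> * r * s * x) + \<i> * of_real (Im c * s * x)"
      by (subst (1) c, subst (2) c) (simp add: algebra_simps)
    show ?thesis
      unfolding 1 2 exp_of_real[symmetric] exp_add[symmetric]
      by (simp add: algebra_simps)
  qed
  have sc: "sqrt (2 * pi) * s = sqrt (pi / \<mu>)"
    using assms by (simp add: s_def real_sqrt_mult real_sqrt_divide)
  have "(Im c * s)\<^sup>2 / 2 = (Im c)\<^sup>2 / (4 * \<mu>)"
    by (simp add: power_mult_distrib s)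
  moreover have "c * of_real r - of_real (\<mu> * r\<^sup>2) - of_real ((Im c)\<^sup>2 / (4 * \<mu>)) = c\<^sup>2 / of_real (4 * \<mu>)"
    using assms
    by (subst (1 2) c) (simp add: power2_eq_square field_simps complex_eq_iff)
  ultimately have ex: "exp (c * of_real r - of_real (\<mu> * r\<^sup>2)) * exp (of_real (- (Im c * s)\<^sup>2 / 2)) = exp (c\<^sup>2 / of_real (4 * \<mu>))"
    by (simp add: exp_add[symmetric] del: of_real_divide of_real_power of_real_mult)
  let ?g = "\<lambda>x. exp (- of_real (\<mu> * x\<^sup>2) + c * of_real x)"
  have hb: "has_bochner_integral lborel (\<lambda>x. ?g (r + s * x))
     (exp (c * of_real r - of_real (\<mu> * r\<^sup>2)) * of_real (sqrt (2 * pi) * exp (- (Im c * s)\<^sup>2 / 2)))"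
    unfolding eq by (intro has_bochner_integral_mult_right has_bochner_integral_gaussian_iexp)
  then have "integrable lborel (\<lambda>x. ?g (r + s * x))"
    by (simp add: has_bochner_integral_iff)
  then have "integrable lborel ?g"
    using s lborel_integrable_real_affine_iff[of s ?g r] by simp
  moreover have "integral\<^sup>L lborel ?g = \<bar>s\<bar> *\<^sub>R (exp (c * of_real r - of_real (\<mu> * r\<^sup>2)) * of_real (sqrt (2 * pi) * exp (- (Im c * s)\<^sup>2 / 2)))"
    using s hb lborel_integral_real_affine[of s ?g r] by (simp add: has_bochner_integral_iff)
  moreover have "\<dots> = of_real (sqrt (2 * pi) * s) * (exp (c * of_real r - of_real (\<mu> * r\<^sup>2)) * exp (of_real (- (Im c * s)\<^sup>2 / 2)))"
    using s by (simp only: scaleR_conv_of_real exp_of_real of_real_mult abs_of_pos mult_ac)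
  ultimately show ?thesis
    unfolding ex sc by (simp add: has_bochner_integral_iff)
qed

text \<open>Fubini in coordinates: \<open>lborel\<close> is the image of the product of real
  Lebesgue measures indexed by \<open>Basis\<close>, under the map sending coordinates to the vector
  they describe.\<close>

lemma has_bochner_integral_lborel_prod:
  fixes f :: "'a::euclidean_space \<Rightarrow> real \<Rightarrow> complex"
  assumes "\<And>b. b \<in> Basis \<Longrightarrow> has_bochner_integral lborel (f b) (I b)"
  shows "has_bochner_integral lborel (\<lambda>p. \<Prod>b\<in>Basis. f b (p \<bullet> b)) (\<Prod>b\<in>Basis. I b)"
proof -
  interpret product_sigma_finite "\<lambda>b::'a. lborel :: real measure" ..
  have int: "integrable lborel (f b)" and I: "integral\<^sup>L lborel (f b) = I b" if "b \<in> Basis" for b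
    using assms[OF that] by (auto simp: has_bochner_integral_iff)
  have [measurable]: "f b \<in> borel_measurable borel" if "b \<in> Basis" for b
    using borel_measurable_integrable[OF int[OF that]] by simp
  have "has_bochner_integral (\<Pi>\<^sub>M b\<in>Basis. lborel) (\<lambda>x. \<Prod>b\<in>Basis. f b (x b)) (\<Prod>b\<in>Basis. I b)"
    using product_integrable_prod[of Basis f] product_integral_prod[of Basis f] int I
    by (simp add: has_bochner_integral_iff)
  moreover have "(\<Prod>b\<in>Basis. f b ((\<Sum>b\<in>Basis. x b *\<^sub>R b) \<bullet> b)) = (\<Prod>b\<in>Basis. f b (x b))" for x
    by (intro prod.cong) auto
  ultimately have "has_bochner_integral (\<Pi>\<^sub>M b\<in>Basis. lborel)
      (\<lambda>x. \<Prod>b\<in>Basis. f b ((\<Sum>b\<in>Basis. x b *\<^sub>R b) \<bullet> b)) (\<Prod>b\<in>Basis. I b)"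
    by simp
  then show ?thesis
    by (subst lborel_eq) (rule has_bochner_integral_distr, auto)
qed

lemma has_bochner_integral_gaussian_euclidean:
  fixes c :: "'a::euclidean_space \<Rightarrow> complex" and \<mu> :: real
  assumes "\<mu> > 0"
  shows "has_bochner_integral lborel
           (\<lambda>p::'a. exp (- of_real (\<mu> * (norm p)\<^sup>2) + (\<Sum>b\<in>Basis. c b * of_real (p \<bullet> b))))
           (of_real (sqrt (pi / \<mu>)) ^ DIM('a) * exp ((\<Sum>b\<in>Basis. (c b)\<^sup>2) / of_real (4 * \<mu>)))"
proof -
  have "- of_real (\<mu> * (norm p)\<^sup>2) + (\<Sum>b\<in>Basis. c b * of_real (p \<bullet> b)) =
      (\<Sum>b\<in>Basis. - of_real (\<mu> * (p \<bullet> b)\<^sup>2) + c b * of_real (p \<bullet> b))" for p :: 'a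
    by (subst power2_norm_eq_inner, subst euclidean_inner)
       (simp add: sum_subtractf sum_distrib_left power2_eq_square)
  then show ?thesis
    using has_bochner_integral_lborel_prod[OF has_bochner_integral_gaussian_complex[OF assms, of "c b" for b]]
    by (simp add: exp_sum prod.distrib sum_divide_distrib)
qed

section \<open>Integrability against exponential growth\<close>

text \<open>Quantifying over every rate \<open>C\<close> makes the class stable under multiplication
  by linear forms and by their exponentials, so one condition serves derivatives of all
  orders.\<close>

definition exp_integrable :: "('a::euclidean_space \<Rightarrow> complex) \<Rightarrow> bool" where
  "exp_integrable G \<longleftrightarrow> G \<in> borel_measurable borel \<and>
     (\<forall>C. integrable lborel (\<lambda>p. norm (G p) * exp (C * norm p)))"

text \<open>An extra factor of exponential growth only moves the rate from \<open>D\<close> to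
  \<open>C + D\<close>, which the hypothesis on \<open>G\<close> still covers.\<close>

lemma exp_integrable_bound:
  assumes G: "exp_integrable G" and H: "H \<in> borel_measurable borel"
    and le: "\<And>p. norm (H p) \<le> norm (G p) * (A * exp (C * norm p))"
  shows "exp_integrable H"
  unfolding exp_integrable_def
proof (intro conjI allI H)
  fix D
  have "integrable lborel (\<lambda>p. A * (norm (G p) * exp ((C + D) * norm p)))"
    using G by (intro integrable_mult_right) (auto simp: exp_integrable_def)
  then show "integrable lborel (\<lambda>p. norm (H p) * exp (D * norm p))"
  proof (rule Bochner_Integration.integrable_bound)
    show "AE p in lborel. norm (norm (H p) * exp (D * norm p)) \<le> norm (A * (norm (G p) * exp ((C + D) * norm p)))"
    proof (rule AE_I2)
      fix p
      have "norm (H p) * exp (D * norm p) \<le> norm (G p) * (A * exp (C * norm p)) * exp (D * norm p)"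
        by (intro mult_right_mono le) auto
      also have "\<dots> = A * (norm (G p) * exp ((C + D) * norm p))"
        by (simp add: algebra_simps exp_add)
      finally show "norm (norm (H p) * exp (D * norm p)) \<le> norm (A * (norm (G p) * exp ((C + D) * norm p)))"
        by (simp add: order_trans[OF _ abs_ge_self])
    qed
  qed (use H in measurable)
qed

lemma exp_integrable_imp_integrable:
  assumes "exp_integrable G"
  shows "integrable lborel G"
proof -
  have "integrable lborel (\<lambda>p. norm (G p) * exp (0 * norm p))"
    using assms unfolding exp_integrable_def by blast
  then show ?thesis
    using assms by (simp add: exp_integrable_def integrable_norm_iff)
qed

text \<open>Linear growth is dominated by exponential growth, since
  \<open>norm p \<le> exp (norm p)\<close>.\<close>

lemma exp_integrable_mult_linear:
  assumes G: "exp_integrable G" and l: "bounded_linear l"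
  shows "exp_integrable (\<lambda>p. G p * l p)"
proof -
  obtain K where K: "K > 0" "\<And>p. norm (l p) \<le> norm p * K"
    using bounded_linear.pos_bounded[OF l] by blast
  have "norm (G p * l p) \<le> norm (G p) * (K * exp (1 * norm p))" for p
  proof -
    have "norm p \<le> exp (norm p)"
      using exp_ge_add_one_self[of "norm p"] by linarith
    then have "norm p * K \<le> exp (norm p) * K"
      using K(1) by (intro mult_right_mono) auto
    then have "norm (l p) \<le> K * exp (norm p)"
      using K(2)[of p] by (simp add: mult.commute)
    then show ?thesis by (simp add: norm_mult mult_left_mono)
  qed
  moreover have "(\<lambda>p. G p * l p) \<in> borel_measurable borel"
    using G borel_measurable_continuous_onI[OF linear_continuous_on[OF l]]
    by (auto simp: exp_integrable_def)
  ultimately show ?thesis using exp_integrable_bound[OF G] by blast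
qed

lemma exp_integrable_mult_power:
  assumes "exp_integrable G" and "bounded_linear l"
  shows "exp_integrable (\<lambda>p. G p * l p ^ n)"
proof (induction n)
  case (Suc n)
  from exp_integrable_mult_linear[OF this assms(2)] show ?case
    by (simp add: mult_ac)
qed (use assms in simp)

lemma exp_integrable_mult_exp:
  assumes G: "exp_integrable G" and l: "bounded_linear l"
  shows "exp_integrable (\<lambda>p. G p * exp (l p))"
proof -
  obtain K where K: "\<And>p. norm (l p) \<le> norm p * K"
    using bounded_linear.bounded[OF l] by blast
  have "norm (G p * exp (l p)) \<le> norm (G p) * (1 * exp (K * norm p))" for p
    using K[of p] complex_Re_le_cmod[of "l p"] by (simp add: norm_mult mult_left_mono mult.commute)
  moreover have "(\<lambda>p. G p * exp (l p)) \<in> borel_measurable borel"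
    using G borel_measurable_continuous_onI[OF linear_continuous_on[OF l]]
    by (auto simp: exp_integrable_def)
  ultimately show ?thesis using exp_integrable_bound[OF G] by blast
qed

lemma exp_integrable_cmult:
  assumes "exp_integrable G"
  shows "exp_integrable (\<lambda>p. c * G p)"
  by (rule exp_integrable_bound[OF assms, where A = "norm c" and C = 0])
     (use assms in \<open>auto simp: exp_integrable_def norm_mult\<close>)

text \<open>Half of the Gaussian exponent pays for the exponential: \<open>C * norm p\<close> is at
  most \<open>\<mu> / 2 * (norm p)\<^sup>2 + C\<^sup>2 / (2 * \<mu>)\<close>, and the other half
  remains integrable.\<close>

lemma exp_integrable_gaussian:
  fixes \<mu> :: real
  assumes "\<mu> > 0"
  shows "exp_integrable (\<lambda>p::'a::euclidean_space. exp (- of_real (\<mu> * (norm p)\<^sup>2)))"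
  unfolding exp_integrable_def
proof (intro conjI allI)
  fix C :: real
  have "integrable lborel (\<lambda>p::'a. exp (- complex_of_real (\<mu> / 2 * (norm p)\<^sup>2)))"
    using has_bochner_integral_gaussian_euclidean[of "\<mu> / 2" "\<lambda>_::'a. 0"] assms
    by (auto simp: has_bochner_integral_iff)
  then have "integrable lborel (\<lambda>p::'a. exp (C\<^sup>2 / (2 * \<mu>)) * norm (exp (- complex_of_real (\<mu> / 2 * (norm p)\<^sup>2))))"
    by (intro integrable_mult_right integrable_norm)
  then show "integrable lborel (\<lambda>p::'a. norm (exp (- complex_of_real (\<mu> * (norm p)\<^sup>2))) * exp (C * norm p))"
  proof (rule Bochner_Integration.integrable_bound)
    show "AE p::'a in lborel. norm (norm (exp (- complex_of_real (\<mu> * (norm p)\<^sup>2))) * exp (C * norm p))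
        \<le> norm (exp (C\<^sup>2 / (2 * \<mu>)) * norm (exp (- complex_of_real (\<mu> / 2 * (norm p)\<^sup>2))))"
    proof (rule AE_I2)
      fix p :: 'a
      have "0 \<le> (\<mu> * norm p - C)\<^sup>2 / (2 * \<mu>)" using assms by simp
      also have "\<dots> = \<mu> / 2 * (norm p)\<^sup>2 - C * norm p + C\<^sup>2 / (2 * \<mu>)"
        using assms by (simp add: power2_eq_square field_simps)
      finally show "norm (norm (exp (- complex_of_real (\<mu> * (norm p)\<^sup>2))) * exp (C * norm p))
        \<le> norm (exp (C\<^sup>2 / (2 * \<mu>)) * norm (exp (- complex_of_real (\<mu> / 2 * (norm p)\<^sup>2))))"
        by (simp add: exp_add[symmetric] norm_mult)
    qed
  qed measurable
qed measurable

section \<open>Differentiation under the integral sign\<close>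

lemma norm_exp_minus_one_minus_id_le:
  fixes w :: complex
  shows "norm (exp w - 1 - w) \<le> exp (norm w) * (norm w)\<^sup>2"
  using Taylor_exp_field[of w 1] by (simp add: power2_eq_square diff_diff_eq)

text \<open>The first-order Taylor remainder of the exponential is quadratic in \<open>t\<close>,
  uniformly enough to integrate; this bounds the error of the linear approximation directly.\<close>

lemma has_vector_derivative_exp_integral:
  assumes G: "exp_integrable G" and l: "bounded_linear l"
  shows "((\<lambda>t::real. \<integral>p. G p * exp (of_real t * l p) \<partial>lborel)
           has_vector_derivative (\<integral>p. G p * l p \<partial>lborel)) (at 0)"
proof -
  define F where "F t = (\<integral>p. G p * exp (of_real t * l p) \<partial>lborel)" for t :: real
  define D where "D = (\<integral>p. G p * l p \<partial>lborel)"
  obtain K where K: "K > 0" "\<And>p. norm (l p) \<le> norm p * K"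
    using bounded_linear.pos_bounded[OF l] by blast
  \<comment> \<open>\<open>B\<close> dominates the Taylor remainder divided by
    \<open>t\<^sup>2\<close> for all \<open>\<bar>t\<bar> \<le> 1\<close> at once.\<close>
  define B where "B p = norm (G p * l p * l p) * exp (K * norm p)" for p
  have intl: "bounded_linear (\<lambda>p. of_real t * l p)" for t :: real
    using bounded_linear_const_mult[OF l] .
  have intB: "integrable lborel B"
    using exp_integrable_mult_linear[OF exp_integrable_mult_linear[OF G l] l]
    unfolding B_def exp_integrable_def by blast
  have int1: "integrable lborel (\<lambda>p. G p * exp (of_real t * l p))" for t :: real
    by (intro exp_integrable_imp_integrable exp_integrable_mult_exp G intl)
  have int2: "integrable lborel (\<lambda>p. G p * l p)"
    by (intro exp_integrable_imp_integrable exp_integrable_mult_linear G l)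
  have int0: "integrable lborel G"
    by (rule exp_integrable_imp_integrable[OF G])
  have bound: "norm (F t - F 0 - t *\<^sub>R D) \<le> t\<^sup>2 * integral\<^sup>L lborel B" if "\<bar>t\<bar> \<le> 1" for t
  proof -
    have "F t - F 0 - t *\<^sub>R D = (\<integral>p. G p * exp (of_real t * l p) - G p - of_real t * (G p * l p) \<partial>lborel)"
      unfolding F_def D_def using int0 int1[of t] int2
      by (simp add: scaleR_conv_of_real)
    also have "norm \<dots> \<le> (\<integral>p. norm (G p * exp (of_real t * l p) - G p - of_real t * (G p * l p)) \<partial>lborel)"
      by (rule integral_norm_bound)
    also have "\<dots> \<le> (\<integral>p. t\<^sup>2 * B p \<partial>lborel)"
    proof (rule integral_mono)
      fix p
      have "G p * exp (of_real t * l p) - G p - of_real t * (G p * l p) = G p * (exp (of_real t * l p) - 1 - of_real t * l p)"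
        by (simp add: algebra_simps)
      also have "norm \<dots> \<le> norm (G p) * (exp (norm (of_real t * l p)) * (norm (of_real t * l p))\<^sup>2)"
        unfolding norm_mult[of "G p"] by (intro mult_left_mono norm_exp_minus_one_minus_id_le) auto
      also have "\<dots> \<le> norm (G p) * (exp (K * norm p) * (norm (of_real t * l p))\<^sup>2)"
      proof (intro mult_left_mono mult_right_mono)
        have "norm (of_real t * l p) \<le> 1 * norm (l p)"
          unfolding norm_mult using that by (intro mult_right_mono) auto
        then show "exp (norm (of_real t * l p)) \<le> exp (K * norm p)"
          using K(2)[of p] by (simp add: mult.commute)
      qed auto
      also have "\<dots> = t\<^sup>2 * B p"
        by (simp add: B_def norm_mult power2_eq_square mult_ac)
      finally show "norm (G p * exp (of_real t * l p) - G p - of_real t * (G p * l p)) \<le> t\<^sup>2 * B p" .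
    qed (use int0 int1[of t] int2 intB in auto)
    finally show ?thesis by simp
  qed
  have "((\<lambda>t. F t) has_derivative (\<lambda>t. t *\<^sub>R D)) (at 0)"
  proof (rule has_derivativeI_sandwich[where e = 1 and H = "\<lambda>t. \<bar>t\<bar> * integral\<^sup>L lborel B"])
    show "((\<lambda>t. \<bar>t\<bar> * integral\<^sup>L lborel B) \<longlongrightarrow> 0) (at (0::real))"
      by (auto intro!: tendsto_eq_intros)
    fix t :: real
    assume t: "t \<in> UNIV" "t \<noteq> 0" "dist t 0 < 1"
    show "norm (F t - F 0 - (t - 0) *\<^sub>R D) / norm (t - 0) \<le> \<bar>t\<bar> * integral\<^sup>L lborel B"
      using bound[of t] t by (simp add: divide_le_eq power2_eq_square mult_ac)
  qed (auto intro: bounded_linear_scaleR_left)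
  then show ?thesis
    by (simp add: has_vector_derivative_def F_def[abs_def] D_def)
qed

section \<open>Wirtinger derivatives of exponential transforms\<close>

text \<open>A Laplace-type transform in which \<open>x\<close> and \<open>cnj x\<close> have
  separate coefficients, matching the two Wirtinger derivatives.\<close>

definition exp_transform ::
  "('a::euclidean_space \<Rightarrow> complex) \<Rightarrow> ('a \<Rightarrow> complex) \<Rightarrow> ('a \<Rightarrow> complex) \<Rightarrow> complex \<Rightarrow> complex" where
  "exp_transform f h G x = (\<integral>p. G p * exp (f p * cnj x + h p * x) \<partial>lborel)"

context
  fixes f h :: "'a::euclidean_space \<Rightarrow> complex"
  assumes f: "bounded_linear f" and h: "bounded_linear h"
begin

lemma bounded_linear_exponent: "bounded_linear (\<lambda>p. f p * a + h p * b)"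
  by (intro bounded_linear_add bounded_linear_mult_const f h)

text \<open>The exponential at the base point \<open>x\<close> is absorbed into the weight, which
  reduces the claim to differentiation at \<open>0\<close>. The directions \<open>1\<close> and
  \<open>\<i>\<close> give the two partial derivatives.\<close>

lemma vector_derivative_exp_transform:
  assumes "exp_integrable G"
  shows "vector_derivative (\<lambda>t::real. exp_transform f h G (x + a * of_real t)) (at 0) =
           exp_transform f h (\<lambda>p. G p * (f p * cnj a + h p * a)) x"
proof -
  have "exp_integrable (\<lambda>p. G p * exp (f p * cnj x + h p * x))"
    by (intro exp_integrable_mult_exp bounded_linear_exponent assms)
  from has_vector_derivative_exp_integral[OF this bounded_linear_exponent[of "cnj a" a]]
  show ?thesis
    unfolding exp_transform_def
    by (intro vector_derivative_at) (simp add: mult.assoc exp_add[symmetric] algebra_simps)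
qed

text \<open>The real direction brings down \<open>f + h\<close> and the imaginary one
  \<open>\<i> * (h - f)\<close>; the two Wirtinger combinations isolate \<open>h\<close> and
  \<open>f\<close>.\<close>

lemma
  assumes G: "exp_integrable G"
  shows wirtinger_exp_transform:
      "wirtinger (exp_transform f h G) = exp_transform f h (\<lambda>p. G p * h p)"
    and wirtinger_bar_exp_transform:
      "wirtinger_bar (exp_transform f h G) = exp_transform f h (\<lambda>p. G p * f p)"
proof -
  have int: "integrable lborel (\<lambda>p. G p * k p * exp (f p * cnj x + h p * x))"
    if "bounded_linear k" for k x
    by (intro exp_integrable_imp_integrable exp_integrable_mult_exp exp_integrable_mult_linear
        bounded_linear_exponent G that)
  let ?f = "exp_transform f h (\<lambda>p. G p * f p)" and ?h = "exp_transform f h (\<lambda>p. G p * h p)"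
  have Re: "partial_Re (exp_transform f h G) x = ?f x + ?h x" for x
    using vector_derivative_exp_transform[OF G, of x 1] int[OF f] int[OF h]
    by (simp add: partial_Re_def exp_transform_def algebra_simps)
  have Im: "partial_Im (exp_transform f h G) x = \<i> * (?h x - ?f x)" for x
  proof -
    have "partial_Im (exp_transform f h G) x = exp_transform f h (\<lambda>p. G p * (f p * cnj \<i> + h p * \<i>)) x"
      unfolding partial_Im_def using vector_derivative_exp_transform[OF G, of x \<i>] by simp
    also have "\<dots> = (\<integral>p. \<i> * (G p * h p * exp (f p * cnj x + h p * x) - G p * f p * exp (f p * cnj x + h p * x)) \<partial>lborel)"
      unfolding exp_transform_def by (simp add: algebra_simps)
    also have "\<dots> = \<i> * (?h x - ?f x)"
      unfolding exp_transform_def integral_mult_right_zero using int[OF f] int[OF h] by simp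
    finally show ?thesis .
  qed
  show "wirtinger (exp_transform f h G) = ?h" "wirtinger_bar (exp_transform f h G) = ?f"
    by (simp_all add: fun_eq_iff wirtinger_def wirtinger_bar_def Re Im field_simps)
qed

lemma wirtinger_funpow_exp_transform:
  assumes "exp_integrable G"
  shows "(wirtinger_bar ^^ m) ((wirtinger ^^ n) (exp_transform f h G)) =
           exp_transform f h (\<lambda>p. G p * f p ^ m * h p ^ n)"
proof -
  have 1: "(wirtinger ^^ n) (exp_transform f h G) = exp_transform f h (\<lambda>p. G p * h p ^ n)"
    by (induction n) (simp_all add: wirtinger_exp_transform exp_integrable_mult_power assms h mult_ac)
  have "(wirtinger_bar ^^ m) (exp_transform f h G') = exp_transform f h (\<lambda>p. G' p * f p ^ m)"
    if "exp_integrable G'" for G'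
    by (induction m) (simp_all add: wirtinger_bar_exp_transform exp_integrable_mult_power that f mult_ac)
  from this[OF exp_integrable_mult_power[OF assms h]] show ?thesis
    by (simp add: 1 mult_ac)
qed

end

text \<open>One variable is differentiated at a time. With \<open>y\<close> fixed, dividing by
  \<open>\<psi> y\<close> exhibits \<open>\<phi>\<close> as an exponential transform; then the roles
  are exchanged.\<close>

lemma wirtinger_funpow_product:
  fixes f\<^sub>1 h\<^sub>1 f\<^sub>2 h\<^sub>2 g :: "'a::euclidean_space \<Rightarrow> complex" and \<phi> \<psi> :: "complex \<Rightarrow> complex"
  assumes lin: "bounded_linear f\<^sub>1" "bounded_linear h\<^sub>1" "bounded_linear f\<^sub>2" "bounded_linear h\<^sub>2"
    and g: "exp_integrable g"
    and rep: "\<And>x y. (\<integral>p. g p * exp (f\<^sub>1 p * cnj x + h\<^sub>1 p * x) * exp (f\<^sub>2 p * cnj y + h\<^sub>2 p * y) \<partial>lborel) = \<phi> x * \<psi> y"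
    and nz: "\<And>x. \<phi> x \<noteq> 0" "\<And>y. \<psi> y \<noteq> 0"
  shows "(wirtinger_bar ^^ m) ((wirtinger ^^ n) \<phi>) x * (wirtinger_bar ^^ m') ((wirtinger ^^ n') \<psi>) y =
           (\<integral>p. g p * f\<^sub>1 p ^ m * h\<^sub>1 p ^ n * f\<^sub>2 p ^ m' * h\<^sub>2 p ^ n'
                  * exp (f\<^sub>1 p * cnj x + h\<^sub>1 p * x) * exp (f\<^sub>2 p * cnj y + h\<^sub>2 p * y) \<partial>lborel)"
proof -
  define D where "D m n = (\<lambda>F. (wirtinger_bar ^^ m) ((wirtinger ^^ n) F))" for m n
  define e\<^sub>1 e\<^sub>2 where "e\<^sub>1 x p = exp (f\<^sub>1 p * cnj x + h\<^sub>1 p * x)" and "e\<^sub>2 y p = exp (f\<^sub>2 p * cnj y + h\<^sub>2 p * y)" for x y p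
  have int\<^sub>1: "exp_integrable (\<lambda>p. G p * e\<^sub>1 x p)" and int\<^sub>2: "exp_integrable (\<lambda>p. G p * e\<^sub>2 x p)" if "exp_integrable G" for G x
    unfolding e\<^sub>1_def e\<^sub>2_def by (intro exp_integrable_mult_exp bounded_linear_exponent lin that)+
  \<comment> \<open>Since \<open>y\<close> is arbitrary here, this is an identity of functions of
    \<open>y\<close>, and it can be differentiated again in \<open>y\<close>.\<close>
  have D\<^sub>1: "D m n \<phi> x * \<psi> y = (\<integral>p. g p * f\<^sub>1 p ^ m * h\<^sub>1 p ^ n * e\<^sub>1 x p * e\<^sub>2 y p \<partial>lborel)" for y
  proof -
    let ?G = "\<lambda>p. inverse (\<psi> y) * (g p * e\<^sub>2 y p)"
    have "\<phi> = exp_transform f\<^sub>1 h\<^sub>1 ?G"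
    proof
      fix x
      have "exp_transform f\<^sub>1 h\<^sub>1 ?G x = inverse (\<psi> y) * (\<integral>p. g p * e\<^sub>1 x p * e\<^sub>2 y p \<partial>lborel)"
        unfolding exp_transform_def e\<^sub>1_def integral_mult_right_zero[symmetric] by (simp add: mult_ac)
      then show "\<phi> x = exp_transform f\<^sub>1 h\<^sub>1 ?G x"
        using nz(2)[of y] by (simp add: e\<^sub>1_def e\<^sub>2_def rep)
    qed
    moreover have "exp_integrable ?G" by (intro exp_integrable_cmult int\<^sub>2 g)
    ultimately have "D m n \<phi> x = (\<integral>p. inverse (\<psi> y) * (g p * f\<^sub>1 p ^ m * h\<^sub>1 p ^ n * e\<^sub>1 x p * e\<^sub>2 y p) \<partial>lborel)"
      unfolding D_def by (simp only: wirtinger_funpow_exp_transform lin) (simp only: exp_transform_def e\<^sub>1_def mult_ac)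
    then show ?thesis using nz(2)[of y] by simp
  qed
  let ?G = "\<lambda>p. inverse (\<phi> x) * (g p * e\<^sub>1 x p)"
  have G: "exp_integrable ?G" by (intro exp_integrable_cmult int\<^sub>1 g)
  have \<psi>: "\<psi> = exp_transform f\<^sub>2 h\<^sub>2 ?G"
  proof
    fix y
    have "exp_transform f\<^sub>2 h\<^sub>2 ?G y = inverse (\<phi> x) * (\<integral>p. g p * e\<^sub>1 x p * e\<^sub>2 y p \<partial>lborel)"
      unfolding exp_transform_def e\<^sub>2_def integral_mult_right_zero[symmetric] by (simp add: mult_ac)
    then show "\<psi> y = exp_transform f\<^sub>2 h\<^sub>2 ?G y"
      using nz(1)[of x] by (simp add: e\<^sub>1_def e\<^sub>2_def rep)
  qed
  define c where "c = D m n \<phi> x"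
  have "c * D m' n' \<psi> y = D m' n' (exp_transform f\<^sub>2 h\<^sub>2 (\<lambda>p. c * ?G p)) y"
    unfolding \<psi> D_def
    by (subst (1 2) wirtinger_funpow_exp_transform) (auto intro: lin G exp_integrable_cmult simp: exp_transform_def mult.assoc)
  \<comment> \<open>The two weights may differ pointwise; their transforms agree because both equal
    \<open>c * \<psi> y\<close> for every \<open>y\<close>.\<close>
  also have "exp_transform f\<^sub>2 h\<^sub>2 (\<lambda>p. c * ?G p) = exp_transform f\<^sub>2 h\<^sub>2 (\<lambda>p. g p * f\<^sub>1 p ^ m * h\<^sub>1 p ^ n * e\<^sub>1 x p)"
  proof
    fix y
    have "exp_transform f\<^sub>2 h\<^sub>2 (\<lambda>p. c * ?G p) y = c * exp_transform f\<^sub>2 h\<^sub>2 ?G y"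
      unfolding exp_transform_def integral_mult_right_zero[symmetric] by (simp add: mult.assoc)
    also have "\<dots> = c * \<psi> y" by (simp add: \<psi>[symmetric])
    finally show "exp_transform f\<^sub>2 h\<^sub>2 (\<lambda>p. c * ?G p) y = exp_transform f\<^sub>2 h\<^sub>2 (\<lambda>p. g p * f\<^sub>1 p ^ m * h\<^sub>1 p ^ n * e\<^sub>1 x p) y"
      unfolding c_def D\<^sub>1 by (simp add: exp_transform_def e\<^sub>2_def)
  qed
  also have "D m' n' \<dots> y = (\<integral>p. g p * f\<^sub>1 p ^ m * h\<^sub>1 p ^ n * e\<^sub>1 x p * f\<^sub>2 p ^ m' * h\<^sub>2 p ^ n' * e\<^sub>2 y p \<partial>lborel)"
    unfolding D_def
    by (subst wirtinger_funpow_exp_transform)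
       (auto intro!: lin int\<^sub>1 exp_integrable_mult_power g simp: exp_transform_def e\<^sub>2_def)
  finally show ?thesis
    by (simp add: c_def D_def e\<^sub>1_def e\<^sub>2_def mult_ac)
qed

section \<open>Gaussian integrals over pairs of complex numbers and the Hermite formula\<close>

text \<open>In real coordinates the first component has coefficients \<open>a + b\<close> and
  \<open>\<i> * (a - b)\<close>, whose squares add up to \<open>4 * a * b\<close>; likewise for
  \<open>c\<close> and \<open>d\<close>.\<close>

lemma has_bochner_integral_gaussian_complex_prod:
  fixes a b c d :: complex and \<mu> :: real
  assumes "\<mu> > 0"
  shows "has_bochner_integral lborel
           (\<lambda>p :: complex \<times> complex. exp (- of_real (\<mu> * (norm p)\<^sup>2)
              + (a * fst p + b * cnj (fst p) + c * snd p + d * cnj (snd p))))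
           ((of_real pi / of_real \<mu>)\<^sup>2 * exp ((a * b + c * d) / of_real \<mu>))"
proof -
  \<comment> \<open>The linear exponent as a function on the whole space: its values at the basis
    vectors are the required real-coordinate coefficients.\<close>
  define k where "k q = a * fst q + b * cnj (fst q) + c * snd q + d * cnj (snd q)" for q
  have sum: "(\<Sum>q\<in>Basis. F q) = F (1, 0) + F (\<i>, 0) + F (0, 1) + F (0, \<i>)" for F :: "complex \<times> complex \<Rightarrow> complex"
    by (simp add: Basis_prod_def Basis_complex_def complex_eq_iff add.assoc)
  have 1: "(\<Sum>q\<in>Basis. k q * of_real (p \<bullet> q)) = k p" for p
    by (cases p) (simp add: sum k_def complex_eq_iff algebra_simps)
  have 2: "(\<Sum>q\<in>Basis. (k q)\<^sup>2) / of_real (4 * \<mu>) = (a * b + c * d) / of_real \<mu>"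
    using assms by (simp add: sum k_def power2_eq_square field_simps)
  have "complex_of_real (sqrt (pi / \<mu>)) ^ 4 = (of_real ((sqrt (pi / \<mu>))\<^sup>2))\<^sup>2"
    by (simp flip: power_mult)
  also have "(sqrt (pi / \<mu>))\<^sup>2 = pi / \<mu>" using assms by simp
  finally have 3: "complex_of_real (sqrt (pi / \<mu>)) ^ 4 = (of_real pi / of_real \<mu>)\<^sup>2" by simp
  show ?thesis
    using has_bochner_integral_gaussian_euclidean[OF assms, of k]
    unfolding 1 2 by (simp add: 3 k_def)
qed

theorem theorem3p18:
  fixes \<alpha> \<beta> :: complex and \<mu> :: real and m n m' n' :: nat and z w :: complex
  assumes "\<alpha> * \<beta> = complex_of_real \<mu>" and "\<mu> > 0"
  shows "integrable (lborel :: (complex \<times> complex) measure)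
           (hermite4_integrand \<mu> \<alpha> \<beta> m n m' n' z w)
       \<and> hermite4 m n m' n' (z / of_real (sqrt 2)) (w / of_real (sqrt 2)) =
           (of_real \<mu>)\<^sup>2 * (- \<alpha>) ^ (m + n') * \<beta> ^ (m' + n)
             / ((of_real pi)\<^sup>2 * (of_real (sqrt 2)) ^ (m + n + m' + n'))
           * exp (of_real ((cmod z)\<^sup>2 + (cmod w)\<^sup>2))
           * (\<integral>p. hermite4_integrand \<mu> \<alpha> \<beta> m n m' n' z w p
                \<partial>(lborel :: (complex \<times> complex) measure))"
proof
  define s :: complex where "s = of_real (sqrt 2)"
  have s: "s * s = 2" "s \<noteq> 0" "cnj s = s"
    by (simp_all add: s_def flip: of_real_mult)
  \<comment> \<open>These are the first arguments of the two \<open>hermite2\<close> factors after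
    rescaling.\<close>
  define x y where "x = (z + \<i> * w) / s" and "y = (cnj z + \<i> * cnj w) / s"
  \<comment> \<open>These are the four bases of the monomial weight; \<open>a'\<close> and
    \<open>b'\<close> are the conjugates of \<open>a\<close> and \<open>b\<close>.\<close>
  define a a' b b' :: "complex \<times> complex \<Rightarrow> complex" where
    "a p = fst p + \<i> * snd p" and "a' p = cnj (fst p) - \<i> * cnj (snd p)" and
    "b p = fst p - \<i> * snd p" and "b' p = cnj (fst p) + \<i> * cnj (snd p)" for p
  \<comment> \<open>The forms are paired so that \<open>m\<close>, \<open>n\<close>,
    \<open>m'\<close>, \<open>n'\<close> become the powers of \<open>a\<close>, \<open>a'\<close>,
    \<open>b'\<close>, \<open>b\<close>. The factors \<open>1 / s\<close> later yield the power of
    \<open>sqrt 2\<close>.\<close>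
  define f\<^sub>1 h\<^sub>1 f\<^sub>2 h\<^sub>2 :: "complex \<times> complex \<Rightarrow> complex" where "f\<^sub>1 p = \<alpha> / s * a p" and "h\<^sub>1 p = - \<beta> / s * a' p"
    and "f\<^sub>2 p = - \<beta> / s * b' p" and "h\<^sub>2 p = \<alpha> / s * b p" for p
  note abs = a_def[abs_def] a'_def[abs_def] b_def[abs_def] b'_def[abs_def]
  note fh = f\<^sub>1_def[abs_def] f\<^sub>2_def[abs_def] h\<^sub>1_def[abs_def] h\<^sub>2_def[abs_def]
  have lin: "bounded_linear a" "bounded_linear a'" "bounded_linear b" "bounded_linear b'"
    unfolding abs
    by (intro bounded_linear_add bounded_linear_sub bounded_linear_const_mult bounded_linear_fst bounded_linear_snd
        bounded_linear_compose[OF bounded_linear_cnj])+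
  have flin: "bounded_linear f\<^sub>1" "bounded_linear h\<^sub>1" "bounded_linear f\<^sub>2" "bounded_linear h\<^sub>2"
    unfolding fh by (intro bounded_linear_const_mult lin)+
  \<comment> \<open>The constant cancels the total Gaussian mass, so that \<open>g\<close>
    represents \<open>e x * e y\<close> exactly.\<close>
  define g :: "complex \<times> complex \<Rightarrow> complex" where "g p = (of_real \<mu> / of_real pi)\<^sup>2 * exp (- of_real (\<mu> * (norm p)\<^sup>2))" for p
  have g: "exp_integrable g"
    unfolding g_def using assms by (intro exp_integrable_cmult exp_integrable_gaussian)
  define e where "e \<xi> = exp (- complex_of_real ((cmod \<xi>)\<^sup>2))" for \<xi>
  have exponent: "f\<^sub>1 p * cnj x + h\<^sub>1 p * x + (f\<^sub>2 p * cnj y + h\<^sub>2 p * y) =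
      (\<alpha> / s * (cnj x + y)) * fst p + (- \<beta> / s * (x + cnj y)) * cnj (fst p)
      + (\<i> * \<alpha> / s * (cnj x - y)) * snd p + (\<i> * \<beta> / s * (x - cnj y)) * cnj (snd p)" for p x y
    unfolding fh abs by (simp add: algebra_simps diff_divide_distrib add_divide_distrib)
  have rep: "(\<integral>p. g p * exp (f\<^sub>1 p * cnj x + h\<^sub>1 p * x) * exp (f\<^sub>2 p * cnj y + h\<^sub>2 p * y) \<partial>lborel) = e x * e y" for x y
  proof -
    let ?A = "\<alpha> / s * (cnj x + y)" and ?B = "- \<beta> / s * (x + cnj y)"
      and ?C = "\<i> * \<alpha> / s * (cnj x - y)" and ?D = "\<i> * \<beta> / s * (x - cnj y)"
    \<comment> \<open>The mixed terms \<open>x * y\<close> and \<open>cnj x * cnj y\<close> cancel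
      between the two products; the remaining factor \<open>2\<close> cancels against
      \<open>s * s\<close>.\<close>
    have "?A * ?B + ?C * ?D = - (\<alpha> * \<beta>) / (s * s) * (2 * (x * cnj x + y * cnj y))"
      using s(2) by (simp add: field_simps)
    also have "\<dots> = of_real \<mu> * (- of_real ((cmod x)\<^sup>2) - of_real ((cmod y)\<^sup>2))"
      unfolding assms(1) s(1) complex_norm_square by (simp add: algebra_simps)
    finally have exp: "exp ((?A * ?B + ?C * ?D) / of_real \<mu>) = e x * e y"
      using assms(2) by (simp add: e_def flip: exp_add)
    have "(\<integral>p. g p * exp (f\<^sub>1 p * cnj x + h\<^sub>1 p * x) * exp (f\<^sub>2 p * cnj y + h\<^sub>2 p * y) \<partial>lborel)
        = (\<integral>p. (of_real \<mu> / of_real pi)\<^sup>2 * exp (- of_real (\<mu> * (norm p)\<^sup>2)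
            + (?A * fst p + ?B * cnj (fst p) + ?C * snd p + ?D * cnj (snd p))) \<partial>lborel)"
      unfolding exponent[symmetric] g_def by (simp only: exp_add mult.assoc)
    also have "\<dots> = (of_real \<mu> / of_real pi)\<^sup>2 * ((of_real pi / of_real \<mu>)\<^sup>2 * (e x * e y))"
      unfolding integral_mult_right_zero exp[symmetric]
      by (subst has_bochner_integral_integral_eq[OF has_bochner_integral_gaussian_complex_prod[OF assms(2)]]) simp
    finally show ?thesis using assms(2) by (simp add: power2_eq_square)
  qed
  let ?I = "hermite4_integrand \<mu> \<alpha> \<beta> m n m' n' z w"
  define k where "k = (of_real \<mu> / of_real pi)\<^sup>2 * (\<alpha> / s) ^ m * (- \<beta> / s) ^ n * (- \<beta> / s) ^ m' * (\<alpha> / s) ^ n'"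
  \<comment> \<open>Inverting the change of variables turns the coefficients in
    \<open>exponent\<close> into those of \<open>E_kernel\<close>.\<close>
  have xy: "cnj x + y = s * cnj z" "x + cnj y = s * z" "cnj x - y = - \<i> * s * cnj w" "x - cnj y = \<i> * s * w"
    using s unfolding x_def y_def by (simp_all add: field_simps)
  have E: "exp (- of_real (\<mu> * (norm p)\<^sup>2)) * (exp (f\<^sub>1 p * cnj x + h\<^sub>1 p * x) * exp (f\<^sub>2 p * cnj y + h\<^sub>2 p * y))
      = E_kernel \<mu> \<alpha> \<beta> (fst p) (snd p) z w" for p
    unfolding exp_add[symmetric] exponent xy E_kernel_def herm_def norm_prod_def
    using s(2) by (simp add: algebra_simps)
  have I: "?I p = exp (- of_real (\<mu> * (norm p)\<^sup>2)) * a p ^ m * a' p ^ n * b' p ^ m' * b p ^ n'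
      * exp (f\<^sub>1 p * cnj x + h\<^sub>1 p * x) * exp (f\<^sub>2 p * cnj y + h\<^sub>2 p * y)" for p
    unfolding hermite4_integrand_def abs split_beta E[symmetric] by (simp add: mult_ac)
  show "integrable lborel ?I"
    unfolding I using assms(2)
    by (intro exp_integrable_imp_integrable exp_integrable_mult_exp exp_integrable_mult_power
        bounded_linear_exponent exp_integrable_gaussian lin flin)
  have kI: "g p * f\<^sub>1 p ^ m * h\<^sub>1 p ^ n * f\<^sub>2 p ^ m' * h\<^sub>2 p ^ n'
      * exp (f\<^sub>1 p * cnj x + h\<^sub>1 p * x) * exp (f\<^sub>2 p * cnj y + h\<^sub>2 p * y) = k * ?I p" for p
    unfolding I k_def g_def f\<^sub>1_def h\<^sub>1_def f\<^sub>2_def h\<^sub>2_def power_mult_distrib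
    by (simp only: mult_ac)
  have D: "(wirtinger_bar ^^ m) ((wirtinger ^^ n) e) x * (wirtinger_bar ^^ m') ((wirtinger ^^ n') e) y = k * integral\<^sup>L lborel ?I"
    using wirtinger_funpow_product[where \<phi> = e and \<psi> = e, OF flin g rep, of m n x m' n' y]
    unfolding kI by (simp add: e_def)
  \<comment> \<open>Parallelogram law: \<open>s * x = z + \<i> * w\<close> and
    \<open>s * cnj y = z - \<i> * w\<close>, while \<open>s * s = 2\<close>.\<close>
  have "complex_of_real ((cmod x)\<^sup>2 + (cmod y)\<^sup>2) = of_real ((cmod z)\<^sup>2 + (cmod w)\<^sup>2)"
    using s unfolding of_real_add complex_norm_square x_def y_def by (simp add: field_simps)
  then have ex: "exp (of_real ((cmod x)\<^sup>2)) * exp (of_real ((cmod y)\<^sup>2)) = exp (complex_of_real ((cmod z)\<^sup>2 + (cmod w)\<^sup>2))"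
    by (simp flip: exp_add)
  have "hermite4 m n m' n' (z / s) (w / s) = hermite2 m n x * hermite2 m' n' y"
    using s by (simp add: hermite4_def x_def y_def add_divide_distrib)
  also have "\<dots> = (- 1) ^ (m + n) * (- 1) ^ (m' + n') * (exp (of_real ((cmod x)\<^sup>2)) * exp (of_real ((cmod y)\<^sup>2)))
      * (k * integral\<^sup>L lborel ?I)"
    unfolding D[symmetric] hermite2_def e_def[abs_def] by (simp only: mult_ac)
  also have "\<dots> = ((- 1) ^ (m + n) * (- 1) ^ (m' + n') * k) * exp (of_real ((cmod z)\<^sup>2 + (cmod w)\<^sup>2)) * integral\<^sup>L lborel ?I"
    unfolding ex by (simp only: mult_ac)
  \<comment> \<open>Each derivative contributes one sign, attached to its own linear form:
    \<open>\<alpha>\<close> becomes \<open>- \<alpha>\<close> for \<open>m + n'\<close> factors, and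
    \<open>- \<beta>\<close> becomes \<open>\<beta>\<close> for \<open>m' + n\<close>.\<close>
  also have "(- 1) ^ (m + n) * (- 1) ^ (m' + n') * k =
      (of_real \<mu>)\<^sup>2 * (- \<alpha>) ^ (m + n') * \<beta> ^ (m' + n) / ((of_real pi)\<^sup>2 * s ^ (m + n + m' + n'))"
  proof -
    have "(- 1) ^ (m + n) * (- 1) ^ (m' + n') * k = (of_real \<mu> / of_real pi)\<^sup>2 *
        (((- 1) * (\<alpha> / s)) ^ (m + n') * ((- 1) * (- \<beta> / s)) ^ (m' + n))"
      unfolding k_def power_mult_distrib power_add by (simp only: mult_ac)
    also have "\<dots> = (of_real \<mu> / of_real pi)\<^sup>2 * ((- \<alpha> / s) ^ (m + n') * (\<beta> / s) ^ (m' + n))"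
      by simp
    finally show ?thesis
      by (simp only: power_divide times_divide_times_eq power_add mult_ac)
  qed
  finally show "hermite4 m n m' n' (z / of_real (sqrt 2)) (w / of_real (sqrt 2)) =
           (of_real \<mu>)\<^sup>2 * (- \<alpha>) ^ (m + n') * \<beta> ^ (m' + n)
             / ((of_real pi)\<^sup>2 * (of_real (sqrt 2)) ^ (m + n + m' + n'))
           * exp (of_real ((cmod z)\<^sup>2 + (cmod w)\<^sup>2))
           * integral\<^sup>L lborel ?I"
    unfolding s_def .
qed

end
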